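(* Let $p,q$ be positive integers. Both the linear optimization problem over the set of $\prec$-maximal (with respect to $\mathfrak{S}_q$) $0/1$-matrices of size $p\times q$ with at most one $1$-entry per row, and the linear optimization problem over the set of $\prec$-maximal (with respect to $\mathfrak{S}_q$) $0/1$-matrices of size $p\times q$ with exactly one $1$-entry per row, can be solved in time $O(p^2q)$.
   Context: Notation: $[n]=\{1,\dots,n\}$. $\mathfrak{S}_q$ is the symmetric group of all permutations of $[q]$, acting on $0/1$-matrices of size $p\times q$ by permuting columns. Let $\prec$ be the lexicographic order on $\{0,1\}^{[p]\times[q]}$ with respect to the row-wise ordering $(1,1)<(1,2)<\dots<(1,q)<(2,1)<\dots<(p,q)$ of positions, i.e. $A\prec B$ iff $a_{k\ell}<b_{k\ell}$ at the first position $(k,\ell)$ where $A,B$ differ. A matrix is $\prec$-maximal with respect to $\mathfrak{S}_q$ if it is the $\prec$-maximum of its $\mathfrak{S}_q$-orbit. The linear optimization problem over a set $X$ of such matrices: given $c\in\mathbb{Q}^{[p]\times[q]}$, find $A^\star\in X$ maximizing $\langle c,A\rangle=\sum_{i=1}^p\sum_{j=1}^q c_{ij}A_{ij}$ over $A\in X$. Running times are counted in the unit-cost (arithmetic operation) model. *)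

theory Defs
  imports "Jordan_Normal_Form.Matrix" "HOL-Combinatorics.Permutations"
begin

section \<open>Lexicographically maximal 0/1-matrices under column permutations\<close>

text \<open>Rows and columns are numbered from \<open>0\<close>, as usual for the type \<open>mat\<close>: the set
  \<open>[p] \<times> [q]\<close> of positions becomes \<open>{..<p} \<times> {..<q}\<close>.\<close>

definition permute_cols :: "(nat \<Rightarrow> nat) \<Rightarrow> 'a mat \<Rightarrow> 'a mat" where
  "permute_cols \<sigma> A = mat (dim_row A) (dim_col A) (\<lambda>(i, j). A $$ (i, \<sigma> j))"

definition col_orbit :: "'a mat \<Rightarrow> 'a mat set" where
  "col_orbit A = {permute_cols \<sigma> A |\<sigma>. \<sigma> permutes {..<dim_col A}}"

text \<open>\<open>less_than <*lex*> less_than\<close> is the row-wise ordering of positions. The relation is only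
  meant for matrices of equal dimensions.\<close>

definition lex_less :: "'a::linorder mat \<Rightarrow> 'a mat \<Rightarrow> bool" where
  "lex_less A B \<longleftrightarrow>
    (\<exists>k < dim_row A. \<exists>l < dim_col A. A $$ (k, l) < B $$ (k, l) \<and>
      (\<forall>i < dim_row A. \<forall>j < dim_col A.
        ((i, j), (k, l)) \<in> less_than <*lex*> less_than \<longrightarrow> A $$ (i, j) = B $$ (i, j)))"

definition lex_maximal :: "'a::linorder mat \<Rightarrow> bool" where
  "lex_maximal A \<longleftrightarrow> (\<forall>B \<in> col_orbit A. B = A \<or> lex_less B A)"

definition zero_one_mats :: "nat \<Rightarrow> nat \<Rightarrow> rat mat set" where
  "zero_one_mats p q = {A \<in> carrier_mat p q. \<forall>i<p. \<forall>j<q. A $$ (i, j) \<in> {0, 1}}"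

definition max_packing_mats :: "nat \<Rightarrow> nat \<Rightarrow> rat mat set" where
  "max_packing_mats p q =
    {A \<in> zero_one_mats p q. lex_maximal A \<and> (\<forall>i<p. card {j. j < q \<and> A $$ (i, j) = 1} \<le> 1)}"

definition max_partitioning_mats :: "nat \<Rightarrow> nat \<Rightarrow> rat mat set" where
  "max_partitioning_mats p q =
    {A \<in> zero_one_mats p q. lex_maximal A \<and> (\<forall>i<p. card {j. j < q \<and> A $$ (i, j) = 1} = 1)}"

definition mat_inner :: "rat mat \<Rightarrow> rat mat \<Rightarrow> rat" where
  "mat_inner c A = (\<Sum>i<dim_row c. \<Sum>j<dim_col c. c $$ (i, j) * A $$ (i, j))"


section \<open>A unit-cost random access machine\<close>

text \<open>
  Programs are structured programs over two sorts of data, natural numbers (used for counting and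
  addressing) and rationals. Each sort has finitely many named registers per program and an
  unbounded indirectly addressed memory. Every node of an expression (constant, register or memory
  access, arithmetic operation, comparison) and every assignment costs one time unit, independently
  of the size of the numbers. There is no conversion between the two sorts, and in particular no
  rounding of rationals. Subtraction of natural numbers is truncated, and division by \<open>0\<close> gives
  \<open>0\<close>, so that all expressions have a value.\<close>

type_synonym vname = string

datatype iexp =
    IConst nat
  | IVar vname
  | ILoad iexp
  | IPlus iexp iexp
  | IMinus iexp iexp
  | ITimes iexp iexp

datatype rexp =
    RConst rat
  | RVar vname
  | RLoad iexp
  | RPlus rexp rexp
  | RMinus rexp rexp
  | RTimes rexp rexp
  | RDiv rexp rexp

datatype bexp =
    ILess iexp iexp
  | RLess rexp rexp

datatype com =
    Skip
  | IAssign vname iexp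
  | RAssign vname rexp
  | IStore iexp iexp
  | RStore iexp rexp
  | Seq com com
  | Cond bexp com com
  | While bexp com

record state =
  ivar :: "vname \<Rightarrow> nat"
  rvar :: "vname \<Rightarrow> rat"
  imem :: "nat \<Rightarrow> nat"
  rmem :: "nat \<Rightarrow> rat"

primrec ival :: "iexp \<Rightarrow> state \<Rightarrow> nat" where
  "ival (IConst n) s = n"
| "ival (IVar x) s = ivar s x"
| "ival (ILoad a) s = imem s (ival a s)"
| "ival (IPlus a b) s = ival a s + ival b s"
| "ival (IMinus a b) s = ival a s - ival b s"
| "ival (ITimes a b) s = ival a s * ival b s"

primrec rval :: "rexp \<Rightarrow> state \<Rightarrow> rat" where
  "rval (RConst r) s = r"
| "rval (RVar x) s = rvar s x"
| "rval (RLoad a) s = rmem s (ival a s)"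
| "rval (RPlus a b) s = rval a s + rval b s"
| "rval (RMinus a b) s = rval a s - rval b s"
| "rval (RTimes a b) s = rval a s * rval b s"
| "rval (RDiv a b) s = rval a s / rval b s"

primrec bval :: "bexp \<Rightarrow> state \<Rightarrow> bool" where
  "bval (ILess a b) s \<longleftrightarrow> ival a s < ival b s"
| "bval (RLess a b) s \<longleftrightarrow> rval a s < rval b s"

primrec icost :: "iexp \<Rightarrow> nat" where
  "icost (IConst n) = 1"
| "icost (IVar x) = 1"
| "icost (ILoad a) = 1 + icost a"
| "icost (IPlus a b) = 1 + icost a + icost b"
| "icost (IMinus a b) = 1 + icost a + icost b"
| "icost (ITimes a b) = 1 + icost a + icost b"

primrec rcost :: "rexp \<Rightarrow> nat" where
  "rcost (RConst r) = 1"
| "rcost (RVar x) = 1"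
| "rcost (RLoad a) = 1 + icost a"
| "rcost (RPlus a b) = 1 + rcost a + rcost b"
| "rcost (RMinus a b) = 1 + rcost a + rcost b"
| "rcost (RTimes a b) = 1 + rcost a + rcost b"
| "rcost (RDiv a b) = 1 + rcost a + rcost b"

primrec bcost :: "bexp \<Rightarrow> nat" where
  "bcost (ILess a b) = 1 + icost a + icost b"
| "bcost (RLess a b) = 1 + rcost a + rcost b"

text \<open>\<open>exec c s t s'\<close>: started in state \<open>s\<close>, the program \<open>c\<close> terminates in state \<open>s'\<close> after
  \<open>t\<close> time units.\<close>

inductive exec :: "com \<Rightarrow> state \<Rightarrow> nat \<Rightarrow> state \<Rightarrow> bool" where
  Skip: "exec Skip s 1 s"
| IAssign: "exec (IAssign x a) s (1 + icost a) (s\<lparr>ivar := (ivar s)(x := ival a s)\<rparr>)"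
| RAssign: "exec (RAssign x a) s (1 + rcost a) (s\<lparr>rvar := (rvar s)(x := rval a s)\<rparr>)"
| IStore: "exec (IStore a b) s (1 + icost a + icost b)
    (s\<lparr>imem := (imem s)(ival a s := ival b s)\<rparr>)"
| RStore: "exec (RStore a b) s (1 + icost a + rcost b)
    (s\<lparr>rmem := (rmem s)(ival a s := rval b s)\<rparr>)"
| Seq: "exec c1 s t1 s' \<Longrightarrow> exec c2 s' t2 s'' \<Longrightarrow> exec (Seq c1 c2) s (t1 + t2) s''"
| CondTrue: "bval b s \<Longrightarrow> exec c1 s t s' \<Longrightarrow> exec (Cond b c1 c2) s (bcost b + t) s'"
| CondFalse: "\<not> bval b s \<Longrightarrow> exec c2 s t s' \<Longrightarrow> exec (Cond b c1 c2) s (bcost b + t) s'"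
| WhileFalse: "\<not> bval b s \<Longrightarrow> exec (While b c) s (bcost b) s"
| WhileTrue: "bval b s \<Longrightarrow> exec c s t1 s' \<Longrightarrow> exec (While b c) s' t2 s'' \<Longrightarrow>
    exec (While b c) s (bcost b + t1 + t2) s''"

inductive_cases exec_elims:
  "exec Skip s t s'"
  "exec (IAssign x a) s t s'"
  "exec (RAssign x ra) s t s'"
  "exec (IStore a b) s t s'"
  "exec (RStore a rb) s t s'"
  "exec (Seq c1 c2) s t s'"
  "exec (Cond bb c1 c2) s t s'"

inductive_cases exec_WhileE: "exec (While b c) s t s'"

lemma exec_deterministic:
  "exec c s t s' \<Longrightarrow> exec c s u s'' \<Longrightarrow> u = t \<and> s'' = s'"
proof (induction arbitrary: u s'' rule: exec.induct)
  case (Seq c1 s t1 s' c2 t2 s3)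
  from Seq.prems show ?case by (rule exec_elims) (use Seq.IH in blast)
next
  case (CondTrue b s c1 t s' c2)
  from CondTrue.prems show ?case
    by (rule exec_elims) (use CondTrue.IH CondTrue.hyps in blast)+
next
  case (CondFalse b s c2 t s' c1)
  from CondFalse.prems show ?case
    by (rule exec_elims) (use CondFalse.IH CondFalse.hyps in blast)+
next
  case (WhileFalse b s c)
  from WhileFalse.prems show ?case
    by (rule exec_WhileE) (use WhileFalse.hyps in blast)+
next
  case (WhileTrue b s c t1 s' t2 s3)
  from WhileTrue.prems show ?case
    by (rule exec_WhileE) (use WhileTrue.IH WhileTrue.hyps in blast)+
qed (auto elim: exec_elims)


section \<open>Linear optimization in bounded time\<close>

text \<open>The dimensions are passed in registers and \<open>c\<close> row by row in the rational memory; everything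
  else is initially \<open>0\<close>. The solution overwrites \<open>c\<close>.\<close>

definition input_state :: "nat \<Rightarrow> nat \<Rightarrow> rat mat \<Rightarrow> state" where
  "input_state p q c =
    \<lparr>ivar = (\<lambda>_. 0)(''p'' := p, ''q'' := q),
     rvar = (\<lambda>_. 0),
     imem = (\<lambda>_. 0),
     rmem = (\<lambda>a. if a < p * q then c $$ (a div q, a mod q) else 0)\<rparr>"

definition output_mat :: "nat \<Rightarrow> nat \<Rightarrow> state \<Rightarrow> rat mat" where
  "output_mat p q s = mat p q (\<lambda>(i, j). rmem s (i * q + j))"

text \<open>One program and one constant \<open>K\<close> have to serve all positive \<open>p\<close> and \<open>q\<close> and all objective
  functions.\<close>

definition linear_optimization_in_time ::
  "(nat \<Rightarrow> nat \<Rightarrow> rat mat set) \<Rightarrow> (nat \<Rightarrow> nat \<Rightarrow> nat) \<Rightarrow> bool" where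
  "linear_optimization_in_time X T \<longleftrightarrow>
    (\<exists>prog K. \<forall>p q. p > 0 \<longrightarrow> q > 0 \<longrightarrow>
      (\<forall>c \<in> carrier_mat p q. \<exists>t s.
        exec prog (input_state p q c) t s \<and> t \<le> K * T p q \<and>
        is_arg_max (mat_inner c) (\<lambda>A. A \<in> X p q) (output_mat p q s)))"

end

theory Submission
  imports Defs
begin

text \<open>
  A matrix with at most one \<open>1\<close> per row is lexicographically maximal iff its columns are used in
  their order: each row has its \<open>1\<close> in a column used before or in the first unused column. Hence
  all that the rows above contribute to the choices of the rows below is the number \<open>m\<close> of columns
  used so far, and a dynamic program over pairs of a row and \<open>m\<close> optimizes over these matrices.
  The best column among the first \<open>m\<close> is updated in constant time when \<open>m\<close> grows by one, so that
  the table is filled in time \<open>O(pq)\<close>. A second pass follows the recorded choices from the top.\<close>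


section \<open>Maximal matrices as restricted growth words\<close>

text \<open>Zero rows will be encoded by the choice \<open>Suc q\<close> instead of
  \<open>q\<close>: since \<open>m\<close> may reach \<open>q\<close>, the choice \<open>q\<close>
  would then count as opening a column.\<close>

definition next_used :: "nat \<Rightarrow> nat \<Rightarrow> nat" where
  "next_used m d = (if d = m then Suc m else m)"

primrec used :: "(nat \<Rightarrow> nat) \<Rightarrow> nat \<Rightarrow> nat" where
  "used w 0 = 0"
| "used w (Suc i) = next_used (used w i) (w i)"

lemma used_mono: "i \<le> k \<Longrightarrow> used w i \<le> used w k"
  by (induction k) (auto simp: le_Suc_eq next_used_def intro: le_SucI)

text \<open>The counter passes from \<open>l\<close> to \<open>Suc l\<close> only in a row that
  chooses column \<open>l\<close>.\<close>

lemma used_hit: "l < used w i \<Longrightarrow> \<exists>k<i. w k = l"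
  by (induction i) (auto simp: next_used_def less_Suc_eq split: if_splits)

text \<open>Of two distinct witness positions, the earlier one lies where the other witness demands
  equality.\<close>

lemma lex_less_antisym:
  assumes "dim_row A = dim_row B" "dim_col A = dim_col B" "lex_less A B"
  shows "\<not> lex_less B A"
proof
  assume "lex_less B A"
  then obtain k l where kl: "k < dim_row B" "l < dim_col B" "B $$ (k, l) < A $$ (k, l)"
    "\<And>i j. i < dim_row B \<Longrightarrow> j < dim_col B \<Longrightarrow>
      ((i, j), (k, l)) \<in> less_than <*lex*> less_than \<Longrightarrow> B $$ (i, j) = A $$ (i, j)"
    unfolding lex_less_def by blast
  from assms(3) obtain k' l' where kl': "k' < dim_row A" "l' < dim_col A" "A $$ (k', l') < B $$ (k', l')"
    "\<And>i j. i < dim_row A \<Longrightarrow> j < dim_col A \<Longrightarrow>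
      ((i, j), (k', l')) \<in> less_than <*lex*> less_than \<Longrightarrow> A $$ (i, j) = B $$ (i, j)"
    unfolding lex_less_def by blast
  consider "((k, l), (k', l')) \<in> less_than <*lex*> less_than" | "(k, l) = (k', l')"
    | "((k', l'), (k, l)) \<in> less_than <*lex*> less_than"
    by (auto simp: in_lex_prod) linarith
  then show False
    using kl kl' assms(1,2) by cases force+
qed

text \<open>The choice \<open>Suc q\<close> stands for a zero row. It is available if \<open>e = 0\<close> (packing) and excluded
  if \<open>e = 1\<close> (partitioning).\<close>

locale growth_words =
  fixes p q e :: nat
  assumes q_pos: "0 < q" and e_le: "e \<le> 1"
begin

definition choices :: "nat \<Rightarrow> nat set" where
  "choices m = {d. d < q \<and> d \<le> m} \<union> {d. d = Suc q \<and> e = 0}"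

lemma finite_choices [simp]: "finite (choices m)"
  by (simp add: choices_def)

lemma choices_nonempty [simp]: "choices m \<noteq> {}"
  using q_pos by (auto simp: choices_def)

definition feasible :: "(nat \<Rightarrow> nat) \<Rightarrow> bool" where
  "feasible w \<longleftrightarrow> (\<forall>i<p. w i \<in> choices (used w i))"

definition word_mat :: "(nat \<Rightarrow> nat) \<Rightarrow> rat mat" where
  "word_mat w = mat p q (\<lambda>(i, j). if w i = j then 1 else 0)"

definition maximal_mats :: "rat mat set" where
  "maximal_mats = {A \<in> zero_one_mats p q. lex_maximal A \<and>
    (\<forall>i<p. e \<le> card {j. j < q \<and> A $$ (i, j) = 1} \<and> card {j. j < q \<and> A $$ (i, j) = 1} \<le> 1)}"

lemma word_mat_simps [simp]:
  "dim_row (word_mat w) = p" "dim_col (word_mat w) = q"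
  "i < p \<Longrightarrow> j < q \<Longrightarrow> word_mat w $$ (i, j) = (if w i = j then 1 else 0)"
  by (auto simp: word_mat_def)

lemma next_used_le: "m \<le> q \<Longrightarrow> d \<in> choices m \<Longrightarrow> next_used m d \<le> q"
  by (auto simp: choices_def next_used_def)

lemma used_le: "feasible w \<Longrightarrow> i \<le> p \<Longrightarrow> used w i \<le> q"
  by (induction i) (auto simp: feasible_def intro: next_used_le)

text \<open>At the first row \<open>i\<close> where a permuted matrix differs, \<sigma> fixes all
  columns used earlier. Hence row \<open>i\<close> opens a new column, and \<sigma> can only move
  its \<open>1\<close> to the right.\<close>

lemma lex_maximal_word_mat:
  assumes "feasible w"
  shows "lex_maximal (word_mat w)"
  unfolding lex_maximal_def
proof
  fix B assume "B \<in> col_orbit (word_mat w)"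
  then obtain \<sigma> where perm: "\<sigma> permutes {..<q}" and B: "B = permute_cols \<sigma> (word_mat w)"
    by (auto simp: col_orbit_def)
  have sig: "\<sigma> j < q \<longleftrightarrow> j < q" for j
    using permutes_in_image[OF perm, of j] by simp
  have inj: "\<sigma> x = \<sigma> y \<longleftrightarrow> x = y" for x y
    using permutes_inj[OF perm] by (auto dest: injD)
  have Bdim: "dim_row B = p" "dim_col B = q" by (auto simp: B permute_cols_def)
  have Bij: "B $$ (i, j) = (if w i = \<sigma> j then 1 else 0)" if "i < p" "j < q" for i j
    using that sig by (auto simp: B permute_cols_def)
  show "B = word_mat w \<or> lex_less B (word_mat w)"
  proof (cases "B = word_mat w")
    case False
    define differ where "differ i \<longleftrightarrow> i < p \<and> (\<exists>j<q. B $$ (i, j) \<noteq> word_mat w $$ (i, j))" for i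
    have "\<exists>i. differ i"
    proof (rule ccontr)
      assume "\<nexists>i. differ i"
      then have "B = word_mat w"
        using Bdim by (intro eq_matI) (simp_all add: differ_def)
      with False show False ..
    qed
    then obtain i where i: "differ i" and first: "\<And>k. k < i \<Longrightarrow> \<not> differ k"
      using LeastI_ex[of differ] not_less_Least by metis
    have ip: "i < p" using i by (simp add: differ_def)
    have agree: "B $$ (k, j) = word_mat w $$ (k, j)" if "k < i" "j < q" for k j
      using first[OF that(1)] that ip by (auto simp: differ_def)
    \<comment> \<open>Column \<open>l\<close> has the only \<open>1\<close> of some earlier row
      \<open>k\<close>, and there both matrices agree; this pins \<sigma> at
      \<open>l\<close>.\<close>
    have fixed: "\<sigma> l = l" if l: "l < used w i" for l
    proof -
      obtain k where k: "k < i" "w k = l" using used_hit[OF l] by blast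
      have "l < q" using l used_le[OF assms, of i] ip by simp
      with agree[OF k(1) this] Bij[of k l] k ip show ?thesis by (auto split: if_splits)
    qed
    obtain j where j: "j < q" "B $$ (i, j) \<noteq> word_mat w $$ (i, j)"
      using i by (auto simp: differ_def)
    have wi: "w i \<in> choices (used w i)" using assms ip by (simp add: feasible_def)
    \<comment> \<open>A zero row stays zero and a \<open>1\<close> in a fixed column stays in place,
      so neither case yields a difference.\<close>
    have "w i = used w i \<and> w i < q"
    proof -
      have lt: "w i < q"
        using j Bij[OF ip j(1)] ip wi sig by (auto simp: choices_def split: if_splits)
      have "\<not> w i < used w i"
        using fixed[of "w i"] j Bij[OF ip j(1)] ip inj by (auto split: if_splits)
      with lt wi show ?thesis by (auto simp: choices_def)
    qed
    then have wm: "w i = used w i" "w i < q" by auto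
    have ne: "\<sigma> (w i) \<noteq> w i"
      using j Bij[OF ip j(1)] ip inj by (auto split: if_splits)
    have "lex_less B (word_mat w)"
      unfolding lex_less_def
    proof (intro exI conjI allI impI)
      show "i < dim_row B" "w i < dim_col B" using ip wm Bdim by auto
      show "B $$ (i, w i) < word_mat w $$ (i, w i)" using ip wm ne Bij by auto
    next
      fix i' j' assume "i' < dim_row B" "j' < dim_col B"
        and "((i', j'), i, w i) \<in> less_than <*lex*> less_than"
      then have "i' < p" "j' < q" "i' < i \<or> i' = i \<and> j' < w i" using Bdim by auto
      then show "B $$ (i', j') = word_mat w $$ (i', j')"
        using agree[of i' j'] fixed[of j'] wm Bij[of i' j'] by (auto split: if_splits)
    qed
    then show ?thesis ..
  qed simp
qed

lemma card_word_row:
  "i < p \<Longrightarrow> card {j. j < q \<and> word_mat w $$ (i, j) = 1} = (if w i < q then 1 else 0)"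
proof -
  assume "i < p"
  then have "{j. j < q \<and> word_mat w $$ (i, j) = 1} = (if w i < q then {w i} else {})"
    by (auto split: if_splits)
  then show ?thesis by simp
qed

lemma word_mat_maximal:
  assumes "feasible w"
  shows "word_mat w \<in> maximal_mats"
proof -
  have "e \<le> (if w i < q then 1 else 0)" if "i < p" for i
    using assms that e_le by (auto simp: feasible_def choices_def)
  then show ?thesis
    using lex_maximal_word_mat[OF assms]
    by (auto simp: maximal_mats_def zero_one_mats_def card_word_row simp del: word_mat_simps(3))
       (auto simp: word_mat_def)
qed

text \<open>If row \<open>i\<close> skipped over an unused column, exchanging that column with the one it uses would
  not change the earlier rows and would make row \<open>i\<close> larger.\<close>

lemma maximal_is_word_mat:
  assumes "A \<in> maximal_mats"
  obtains w where "feasible w" "A = word_mat w"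
proof -
  have dim: "dim_row A = p" "dim_col A = q"
    and zo: "\<And>i j. i < p \<Longrightarrow> j < q \<Longrightarrow> A $$ (i, j) = 0 \<or> A $$ (i, j) = 1"
    and max: "lex_maximal A"
    and cards: "\<And>i. i < p \<Longrightarrow> e \<le> card {j. j < q \<and> A $$ (i, j) = 1}"
      "\<And>i. i < p \<Longrightarrow> card {j. j < q \<and> A $$ (i, j) = 1} \<le> 1"
    using assms by (auto simp: maximal_mats_def zero_one_mats_def)
  \<comment> \<open>\<open>d\<close> is the column of the only \<open>1\<close>, or
    \<open>Suc q\<close> for a zero row, which the lower bound \<open>e\<close> on the cardinality
    allows only for \<open>e = 0\<close>.\<close>
  have "\<exists>d. (\<forall>j<q. A $$ (i, j) = (if d = j then 1 else 0)) \<and> (d < q \<or> d = Suc q \<and> e = 0)"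
    if i: "i < p" for i
  proof (cases "{j. j < q \<and> A $$ (i, j) = 1} = {}")
    case True
    then have "e = 0" using cards(1)[OF i] by (simp only: card.empty)
    with True show ?thesis
      using zo[OF i] by (intro exI[of _ "Suc q"]) auto
  next
    case False
    then have "card {j. j < q \<and> A $$ (i, j) = 1} = 1"
      using cards(2)[OF i] by (simp add: le_antisym Suc_leI card_gt_0_iff)
    then obtain d where "{j. j < q \<and> A $$ (i, j) = 1} = {d}" by (auto simp: card_1_singleton_iff)
    then have "d < q" "\<And>j. j < q \<Longrightarrow> A $$ (i, j) = 1 \<longleftrightarrow> j = d" by blast+
    then show ?thesis using zo[OF i] by (intro exI[of _ d]) auto
  qed
  then obtain w where w: "\<And>i j. i < p \<Longrightarrow> j < q \<Longrightarrow> A $$ (i, j) = (if w i = j then 1 else 0)"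
    and wq: "\<And>i. i < p \<Longrightarrow> w i < q \<or> w i = Suc q \<and> e = 0"
    by metis
  have "w i \<in> choices (used w i)" if "i < p" for i
    using that
  proof (induction i rule: less_induct)
    case (less i)
    define m where "m = used w i"
    \<comment> \<open>Earlier rows are feasible by induction, so they are zero or have their
      \<open>1\<close> left of column \<open>m\<close>. Swapping \<open>m\<close> with a column
      further right leaves them unchanged.\<close>
    have old: "w k < m \<or> q < w k" if "k < i" for k
    proof -
      have "w k \<in> choices (used w k)" using less that by simp
      then have "w k < used w (Suc k) \<or> q < w k" by (auto simp: choices_def next_used_def)
      then show ?thesis using used_mono[of "Suc k" i w] that by (auto simp: m_def)
    qed
    show ?case
    proof (rule ccontr)
      assume "w i \<notin> choices (used w i)"
      then have j: "w i < q" "m < w i" using wq[OF less.prems] by (auto simp: choices_def m_def)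
      define \<sigma> where "\<sigma> = transpose m (w i)"
      define B where "B = permute_cols \<sigma> A"
      have perm: "\<sigma> permutes {..<q}" using j by (auto simp: \<sigma>_def intro: permutes_swap_id)
      have sig: "\<sigma> l < q \<longleftrightarrow> l < q" for l
        using permutes_in_image[OF perm, of l] by simp
      have orbit: "B \<in> col_orbit A" using perm dim by (auto simp: col_orbit_def B_def)
      have Bdim: "dim_row B = p" "dim_col B = q" using dim by (auto simp: B_def permute_cols_def)
      have Bij: "B $$ (k, l) = (if w k = \<sigma> l then 1 else 0)" if "k < p" "l < q" for k l
        using that dim sig w by (auto simp: B_def permute_cols_def)
      \<comment> \<open>The first difference is at \<open>(i, m)\<close>: the \<open>1\<close> of
        row \<open>i\<close> lies further right in \<open>A\<close>, and the swap brings it to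
        \<open>m\<close>.\<close>
      have less_B: "lex_less A B"
        unfolding lex_less_def
      proof (intro exI conjI allI impI)
        show "i < dim_row A" "m < dim_col A" using less.prems j dim by auto
        show "A $$ (i, m) < B $$ (i, m)" using less.prems j w Bij by (auto simp: \<sigma>_def)
      next
        fix k l assume kl: "k < dim_row A" "l < dim_col A"
          and "((k, l), i, m) \<in> less_than <*lex*> less_than"
        then consider "k < i" | "k = i" "l < m" by auto
        then show "A $$ (k, l) = B $$ (k, l)"
        proof cases
          case 1
          then show ?thesis
            using old[OF 1] kl dim j w Bij by (auto simp: \<sigma>_def transpose_def)
        next
          case 2
          then show ?thesis
            using kl dim j w Bij by (auto simp: \<sigma>_def transpose_def)
        qed
      qed
      have "B \<noteq> A" "\<not> lex_less B A"
        using less_B lex_less_antisym[of A B] dim Bdim by auto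
      then show False using max orbit by (auto simp: lex_maximal_def)
    qed
  qed
  then have "feasible w" by (simp add: feasible_def)
  moreover have "A = word_mat w"
    using dim w by (intro eq_matI) auto
  ultimately show ?thesis using that by blast
qed

end


section \<open>Dynamic programming\<close>

locale growth_dp = growth_words +
  fixes c :: "rat mat"
  assumes c_carrier: "c \<in> carrier_mat p q"
begin

definition gain :: "nat \<Rightarrow> nat \<Rightarrow> rat" where
  "gain i d = (if d < q then c $$ (i, d) else 0)"

lemma mat_inner_word_mat: "mat_inner c (word_mat w) = (\<Sum>i<p. gain i (w i))"
  unfolding mat_inner_def
proof (rule sum.cong)
  fix i assume "i \<in> {..<p}"
  then have "(\<Sum>j<dim_col c. c $$ (i, j) * word_mat w $$ (i, j)) =
    (\<Sum>j<q. if w i = j then c $$ (i, j) else 0)"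
    using c_carrier by (intro sum.cong) auto
  also have "\<dots> = gain i (w i)"
    by (simp add: gain_def)
  finally show "(\<Sum>j<dim_col c. c $$ (i, j) * word_mat w $$ (i, j)) = gain i (w i)" .
qed (use c_carrier in auto)

text \<open>\<open>opt r m\<close> is the best gain of the last \<open>r\<close> rows if the rows above use the first \<open>m\<close> columns.\<close>

primrec opt :: "nat \<Rightarrow> nat \<Rightarrow> rat" where
  "opt 0 m = 0"
| "opt (Suc r) m = Max ((\<lambda>d. gain (p - Suc r) d + opt r (next_used m d)) ` choices m)"

definition optimal_choice :: "nat \<Rightarrow> nat \<Rightarrow> nat \<Rightarrow> bool" where
  "optimal_choice i m d \<longleftrightarrow> d \<in> choices m \<and>
    opt (p - i) m = gain i d + opt (p - Suc i) (next_used m d)"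

text \<open>Rows count from the top, whereas \<open>opt\<close> recurses on the number of remaining
  rows; this restates the recursion by row number.\<close>

lemma opt_step:
  "i < p \<Longrightarrow> opt (p - i) m =
    Max ((\<lambda>d. gain i d + opt (p - Suc i) (next_used m d)) ` choices m)"
  by (simp add: Suc_diff_Suc[symmetric])

lemma opt_upper:
  "i < p \<Longrightarrow> d \<in> choices m \<Longrightarrow> gain i d + opt (p - Suc i) (next_used m d) \<le> opt (p - i) m"
  by (auto simp: opt_step intro!: Max_ge)

lemma optimal_choiceI:
  assumes "i < p" "d \<in> choices m"
    and "\<And>d'. d' \<in> choices m \<Longrightarrow> gain i d' + opt (p - Suc i) (next_used m d') \<le>
      gain i d + opt (p - Suc i) (next_used m d)"
  shows "optimal_choice i m d"
  using assms by (auto simp: optimal_choice_def opt_step intro!: Max_eqI)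

text \<open>Backward induction from the last row: the choice in row \<open>i\<close> is one of the
  candidates in the maximum that defines \<open>opt\<close>.\<close>

lemma feasible_gain_le:
  assumes "feasible w" "i \<le> p"
  shows "(\<Sum>k=i..<p. gain k (w k)) \<le> opt (p - i) (used w i)"
  using assms(2)
proof (induction rule: inc_induct)
  case (step i)
  have "(\<Sum>k=i..<p. gain k (w k)) = gain i (w i) + (\<Sum>k=Suc i..<p. gain k (w k))"
    using step by (simp add: sum.atLeast_Suc_lessThan)
  also have "\<dots> \<le> gain i (w i) + opt (p - Suc i) (next_used (used w i) (w i))"
    using step by simp
  also have "\<dots> \<le> opt (p - i) (used w i)"
    using assms step by (intro opt_upper) (auto simp: feasible_def)
  finally show ?case .
qed simp

text \<open>The same backward induction, with equality in every row because each choice attains the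
  maximum.\<close>

lemma optimal_gain_eq:
  assumes "\<And>i. i < p \<Longrightarrow> optimal_choice i (used w i) (w i)" "i \<le> p"
  shows "(\<Sum>k=i..<p. gain k (w k)) = opt (p - i) (used w i)"
  using assms(2)
proof (induction rule: inc_induct)
  case (step i)
  then show ?case
    using assms(1)[of i] by (simp add: sum.atLeast_Suc_lessThan optimal_choice_def)
qed simp

text \<open>Every competitor comes from a feasible word and is bounded by \<open>opt p 0\<close>,
  which a word of optimal choices attains.\<close>

lemma optimal_word:
  assumes "\<And>i. i < p \<Longrightarrow> optimal_choice i (used w i) (w i)"
  shows "is_arg_max (mat_inner c) (\<lambda>A. A \<in> maximal_mats) (word_mat w)"
proof -
  have feas: "feasible w" using assms by (auto simp: feasible_def optimal_choice_def)
  have "mat_inner c A \<le> mat_inner c (word_mat w)" if A: "A \<in> maximal_mats" for A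
  proof -
    obtain v where v: "feasible v" "A = word_mat v" using maximal_is_word_mat[OF A] .
    have "mat_inner c A \<le> opt p 0"
      using feasible_gain_le[OF v(1), of 0] by (simp add: v mat_inner_word_mat atLeast0LessThan)
    also have "\<dots> = mat_inner c (word_mat w)"
      using optimal_gain_eq[OF assms, of 0] by (simp add: mat_inner_word_mat atLeast0LessThan)
    finally show ?thesis .
  qed
  then show ?thesis
    using word_mat_maximal[OF feas] by (auto simp: is_arg_max_def not_less)
qed

end


section \<open>Running times of programs\<close>

definition runs :: "com \<Rightarrow> state \<Rightarrow> nat \<Rightarrow> (state \<Rightarrow> bool) \<Rightarrow> bool" where
  "runs b s T Q \<longleftrightarrow> (\<exists>t s'. exec b s t s' \<and> t \<le> T \<and> Q s')"

primrec loop_free :: "com \<Rightarrow> bool" where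
  "loop_free Skip \<longleftrightarrow> True"
| "loop_free (IAssign x a) \<longleftrightarrow> True"
| "loop_free (RAssign x a) \<longleftrightarrow> True"
| "loop_free (IStore a b) \<longleftrightarrow> True"
| "loop_free (RStore a b) \<longleftrightarrow> True"
| "loop_free (Seq a b) \<longleftrightarrow> loop_free a \<and> loop_free b"
| "loop_free (Cond t a b) \<longleftrightarrow> loop_free a \<and> loop_free b"
| "loop_free (While t a) \<longleftrightarrow> False"

text \<open>The values of \<open>effect\<close> and \<open>duration\<close> on loops are meaningless.\<close>

primrec effect :: "com \<Rightarrow> state \<Rightarrow> state" where
  "effect Skip s = s"
| "effect (IAssign x a) s = s\<lparr>ivar := (ivar s)(x := ival a s)\<rparr>"
| "effect (RAssign x a) s = s\<lparr>rvar := (rvar s)(x := rval a s)\<rparr>"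
| "effect (IStore a b) s = s\<lparr>imem := (imem s)(ival a s := ival b s)\<rparr>"
| "effect (RStore a b) s = s\<lparr>rmem := (rmem s)(ival a s := rval b s)\<rparr>"
| "effect (Seq a b) s = effect b (effect a s)"
| "effect (Cond t a b) s = (if bval t s then effect a s else effect b s)"
| "effect (While t a) s = s"

text \<open>Adding both branches of \<open>Cond\<close> gives an upper bound that does not depend on
  the state.\<close>

primrec duration :: "com \<Rightarrow> nat" where
  "duration Skip = 1"
| "duration (IAssign x a) = 1 + icost a"
| "duration (RAssign x a) = 1 + rcost a"
| "duration (IStore a b) = 1 + icost a + icost b"
| "duration (RStore a b) = 1 + icost a + rcost b"
| "duration (Seq a b) = duration a + duration b"
| "duration (Cond t a b) = bcost t + duration a + duration b"
| "duration (While t a) = 0"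

text \<open>Without loops the final state is an explicit function of the initial one, so loop bodies
  can be verified by simplifying \<open>effect\<close>.\<close>

lemma exec_loop_free:
  "loop_free b \<Longrightarrow> \<exists>t \<le> duration b. exec b s t (effect b s)"
proof (induction b arbitrary: s)
  case Skip
  show ?case using exec.Skip[of s] by auto
next
  case (Seq b1 b2)
  then obtain t1 t2 where "t1 \<le> duration b1" "exec b1 s t1 (effect b1 s)"
    "t2 \<le> duration b2" "exec b2 (effect b1 s) t2 (effect b2 (effect b1 s))"
    by force
  then show ?case by (intro exI[of _ "t1 + t2"]) (auto intro: exec.Seq)
next
  case (Cond t b1 b2)
  then obtain t1 t2 where "t1 \<le> duration b1" "exec b1 s t1 (effect b1 s)"
    "t2 \<le> duration b2" "exec b2 s t2 (effect b2 s)"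
    by force
  then show ?case
    by (cases "bval t s")
       (auto intro: exI[of _ "bcost t + t1"] exI[of _ "bcost t + t2"] exec.CondTrue exec.CondFalse)
qed (auto intro: exec.IAssign[simplified] exec.RAssign[simplified]
    exec.IStore[simplified] exec.RStore[simplified])

lemma runs_loop_free:
  "loop_free b \<Longrightarrow> Q (effect b s) \<Longrightarrow> duration b \<le> T \<Longrightarrow> runs b s T Q"
  unfolding runs_def using exec_loop_free[of b s] le_trans by blast

lemma runs_weaken:
  "runs b s T P \<Longrightarrow> (\<And>s. P s \<Longrightarrow> Q s) \<Longrightarrow> T \<le> U \<Longrightarrow> runs b s U Q"
  unfolding runs_def using le_trans by blast

lemma runs_Seq:
  assumes "runs a s T P" "\<And>s. P s \<Longrightarrow> runs b s U Q"
  shows "runs (Seq a b) s (T + U) Q"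
  using assms unfolding runs_def by (meson add_mono exec.Seq)

text \<open>The index of \<open>I\<close> counts completed iterations. Each of the remaining
  \<open>n - k\<close> pays for one test and the body; the last summand pays for the failing
  test.\<close>

lemma runs_While:
  assumes "I k s" "k \<le> n"
    and step: "\<And>k s. I k s \<Longrightarrow> k < n \<Longrightarrow> bval t s \<and> runs b s T (I (Suc k))"
    and exit: "\<And>s. I n s \<Longrightarrow> \<not> bval t s"
  shows "runs (While t b) s ((n - k) * (bcost t + T) + bcost t) (I n)"
  using assms(2,1)
proof (induction arbitrary: s rule: inc_induct)
  case base
  then show ?case
    unfolding runs_def using exec.WhileFalse[OF exit] by fastforce
next
  case (step m)
  from assms(3)[OF step.prems step.hyps(2)] have t: "bval t s" and "runs b s T (I (Suc m))"
    by auto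
  then obtain t1 s1 where 1: "exec b s t1 s1" "t1 \<le> T" "I (Suc m) s1"
    unfolding runs_def by blast
  from step.IH[OF 1(3)] obtain t2 s2 where 2: "exec (While t b) s1 t2 s2"
    "t2 \<le> (n - Suc m) * (bcost t + T) + bcost t" "I n s2"
    unfolding runs_def by blast
  have "n - m = Suc (n - Suc m)" using step.hyps by simp
  then have "bcost t + t1 + t2 \<le> (n - m) * (bcost t + T) + bcost t"
    using 1 2 by simp
  then show ?case
    unfolding runs_def using exec.WhileTrue[OF t 1(1) 2(1)] 2(3) by blast
qed


section \<open>The program\<close>

text \<open>The rational memory holds the costs, followed from \<open>p * q\<close> on by a single
  row of \<open>opt\<close>. Rows of recorded choices have length \<open>q + 1\<close> because
  \<open>m\<close> ranges from \<open>0\<close> to \<open>q\<close>.\<close>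

abbreviation "cost_addr \<equiv> IPlus (ITimes (IVar ''i'') (IVar ''q'')) (IVar ''m'')"
abbreviation "opt_addr \<equiv> IPlus (ITimes (IVar ''p'') (IVar ''q'')) (IVar ''m'')"
abbreviation "choice_addr \<equiv>
  IPlus (ITimes (IVar ''i'') (IPlus (IVar ''q'') (IConst 1))) (IVar ''m'')"

text \<open>\<open>v\<close> and \<open>d\<close> are the best value so far and its choice,
  \<open>x\<close> is the cost in column \<open>m\<close>, and \<open>w\<close> is the value of
  opening that column.\<close>

abbreviation "open_column \<equiv>
  Seq (RAssign ''v'' (RVar ''w'')) (IAssign ''d'' (IVar ''m''))"
abbreviation "update_best \<equiv>
  Seq (RAssign ''best'' (RVar ''x'')) (IAssign ''arg'' (IVar ''m''))"

text \<open>\<open>best\<close> is the largest gain in row \<open>i\<close> without opening a new column, attained by \<open>arg\<close>. For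
  \<open>m < e\<close> this would be a maximum over the empty set, and a new column has to be opened.\<close>

definition cell_step :: com where
  "cell_step =
    Seq (RAssign ''v'' (RPlus (RVar ''best'') (RLoad opt_addr)))
    (Seq (IAssign ''d'' (IVar ''arg''))
    (Seq (Cond (ILess (IVar ''m'') (IVar ''q''))
      (Seq (RAssign ''x'' (RLoad cost_addr))
      (Seq (RAssign ''w'' (RPlus (RVar ''x'') (RLoad (IPlus opt_addr (IConst 1)))))
      (Cond (ILess (IVar ''m'') (IVar ''e''))
        (Seq open_column update_best)
        (Seq (Cond (RLess (RVar ''v'') (RVar ''w'')) open_column Skip)
          (Cond (RLess (RVar ''best'') (RVar ''x'')) update_best Skip)))))
      Skip)
    (Seq (RStore opt_addr (RVar ''v''))
    (Seq (IStore choice_addr (IVar ''d''))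
    (IAssign ''m'' (IPlus (IVar ''m'') (IConst 1)))))))"

text \<open>With no column in use only the zero row, \<open>q + 1\<close> with gain
  \<open>0\<close>, is available. For \<open>e = 1\<close> these values are placeholders that the
  first cell overwrites.\<close>

definition row_init :: com where
  "row_init =
    Seq (IAssign ''i'' (IMinus (IVar ''i'') (IConst 1)))
    (Seq (IAssign ''m'' (IConst 0))
    (Seq (RAssign ''best'' (RConst 0))
    (IAssign ''arg'' (IPlus (IVar ''q'') (IConst 1)))))"

definition row_loop :: com where
  "row_loop = While (ILess (IVar ''m'') (IPlus (IVar ''q'') (IConst 1))) cell_step"

definition table_loop :: com where
  "table_loop = While (ILess (IConst 0) (IVar ''i'')) (Seq row_init row_loop)"

text \<open>The recorded choices determine the solution, so the costs can give way to a zero matrix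
  into which the ones are written.\<close>

definition clear_step :: com where
  "clear_step =
    Seq (RStore (IVar ''k'') (RConst 0)) (IAssign ''k'' (IPlus (IVar ''k'') (IConst 1)))"

definition clear_loop :: com where
  "clear_loop = While (ILess (IVar ''k'') (ITimes (IVar ''p'') (IVar ''q''))) clear_step"

text \<open>A zero row fails the test \<open>d < q\<close> and writes nothing. Only strict
  comparisons exist, so \<open>d = m\<close> is the case where both fail.\<close>

definition write_step :: com where
  "write_step =
    Seq (IAssign ''d'' (ILoad choice_addr))
    (Seq (Cond (ILess (IVar ''d'') (IVar ''q''))
      (RStore (IPlus (ITimes (IVar ''i'') (IVar ''q'')) (IVar ''d'')) (RConst 1)) Skip)
    (Seq (Cond (ILess (IVar ''d'') (IVar ''m'')) Skip
      (Cond (ILess (IVar ''m'') (IVar ''d'')) Skip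
        (IAssign ''m'' (IPlus (IVar ''m'') (IConst 1)))))
    (IAssign ''i'' (IPlus (IVar ''i'') (IConst 1)))))"

definition write_loop :: com where
  "write_loop = While (ILess (IVar ''i'') (IVar ''p'')) write_step"

definition dp_program :: "nat \<Rightarrow> com" where
  "dp_program e =
    Seq (Seq (IAssign ''e'' (IConst e)) (IAssign ''i'' (IVar ''p'')))
    (Seq table_loop
    (Seq (Seq (IAssign ''k'' (IConst 0)) (IAssign ''m'' (IConst 0)))
    (Seq clear_loop write_loop)))"

lemma loop_free_steps [simp]:
  "loop_free row_init" "loop_free cell_step" "loop_free clear_step" "loop_free write_step"
  by (simp_all add: row_init_def cell_step_def clear_step_def write_step_def)

lemma address_inj:
  fixes i j i' j' n :: nat
  assumes "j < n" "j' < n"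
  shows "i * n + j = i' * n + j' \<longleftrightarrow> i = i' \<and> j = j'"
proof
  assume eq: "i * n + j = i' * n + j'"
  have "(i * n + j) div n = i" "(i * n + j) mod n = j" "(i' * n + j') div n = i'" "(i' * n + j') mod n = j'"
    using assms by auto
  with eq show "i = i' \<and> j = j'" by metis
qed simp

text \<open>Separates the cost cells from the \<open>opt\<close> cells, which start at
  \<open>p * q\<close>.\<close>

lemma address_less:
  fixes i j p n :: nat
  assumes "i < p" "j < n"
  shows "i * n + j < p * n"
proof -
  have "i * n + j < Suc i * n" using assms by simp
  also have "\<dots> \<le> p * n" using assms by (intro mult_le_mono1) simp
  finally show ?thesis .
qed

context growth_dp
begin

section \<open>Invariants for filling the table\<close>

definition header :: "state \<Rightarrow> bool" where
  "header s \<longleftrightarrow> ivar s ''p'' = p \<and> ivar s ''q'' = q \<and> ivar s ''e'' = e"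

definition costs_stored :: "state \<Rightarrow> bool" where
  "costs_stored s \<longleftrightarrow> (\<forall>i<p. \<forall>j<q. rmem s (i * q + j) = c $$ (i, j))"

definition choices_stored :: "nat \<Rightarrow> state \<Rightarrow> bool" where
  "choices_stored r s \<longleftrightarrow>
    (\<forall>i. r \<le> i \<longrightarrow> i < p \<longrightarrow> (\<forall>m\<le>q. optimal_choice i m (imem s (i * (q + 1) + m))))"

definition table_inv :: "nat \<Rightarrow> state \<Rightarrow> bool" where
  "table_inv k s \<longleftrightarrow> header s \<and> costs_stored s \<and> choices_stored (p - k) s \<and>
    ivar s ''i'' = p - k \<and> ivar s ''k'' = 0 \<and> (\<forall>m\<le>q. rmem s (p * q + m) = opt k m)"

definition old_choices :: "nat \<Rightarrow> nat set" where
  "old_choices m = {d. d < m} \<union> {d. d = Suc q \<and> e = 0}"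

text \<open>For \<open>m < e\<close> there is no old choice and nothing is claimed, which admits the
  placeholders of \<open>row_init\<close>.\<close>

definition best_old :: "nat \<Rightarrow> nat \<Rightarrow> nat \<Rightarrow> rat \<Rightarrow> bool" where
  "best_old i m d b \<longleftrightarrow> (e \<le> m \<longrightarrow> d \<in> old_choices m \<and> gain i d = b \<and>
    (\<forall>d'\<in>old_choices m. gain i d' \<le> b))"

text \<open>One row of \<open>opt\<close> is updated in place: cells below \<open>k\<close> belong
  to row \<open>i\<close>, the others still to the row below. Ascending order works because cell
  \<open>m\<close> depends only on the old cells \<open>m\<close> and \<open>Suc m\<close>.\<close>

definition row_inv :: "nat \<Rightarrow> nat \<Rightarrow> state \<Rightarrow> bool" where
  "row_inv i k s \<longleftrightarrow> header s \<and> costs_stored s \<and> choices_stored (Suc i) s \<and>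
    ivar s ''i'' = i \<and> ivar s ''k'' = 0 \<and> ivar s ''m'' = k \<and>
    (\<forall>m<k. rmem s (p * q + m) = opt (p - i) m) \<and>
    (\<forall>m. k \<le> m \<longrightarrow> m \<le> q \<longrightarrow> rmem s (p * q + m) = opt (p - Suc i) m) \<and>
    (\<forall>m<k. optimal_choice i m (imem s (i * (q + 1) + m))) \<and>
    (k \<le> q \<longrightarrow> best_old i k (ivar s ''arg'') (rvar s ''best''))"

text \<open>The choice that \<open>cell_step\<close> records, given the best old choice
  \<open>d\<close> of gain \<open>y\<close>; a tie keeps the old choice.\<close>

definition cell_choice :: "nat \<Rightarrow> nat \<Rightarrow> nat \<Rightarrow> rat \<Rightarrow> nat" where
  "cell_choice i k d y = (if k < q \<and> (k < e \<or>
      y + opt (p - Suc i) k < c $$ (i, k) + opt (p - Suc i) (Suc k)) then k else d)"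

lemma choices_eq: "k \<le> q \<Longrightarrow> choices k = old_choices k \<union> {d. d = k \<and> k < q}"
  by (auto simp: choices_def old_choices_def)

lemma next_used_old: "k \<le> q \<Longrightarrow> d \<in> old_choices k \<Longrightarrow> next_used k d = k"
  by (auto simp: old_choices_def next_used_def)

text \<open>All old choices leave the counter at \<open>k\<close> and share the same continuation,
  so only the one of largest gain has to compete with opening column \<open>k\<close>.\<close>

lemma optimal_cell_choice:
  assumes "i < p" "k \<le> q" and best: "best_old i k d y"
  shows "optimal_choice i k (cell_choice i k d y)"
proof (cases "k < e")
  case True
  then have k: "k = 0" "e \<noteq> 0" using e_le by auto
  then have "choices k = {0}" using q_pos by (auto simp: choices_def)
  then show ?thesis
    using assms(1) q_pos k by (intro optimal_choiceI) (auto simp: cell_choice_def)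
next
  case False
  then have d: "d \<in> old_choices k" "gain i d = y" "\<And>d'. d' \<in> old_choices k \<Longrightarrow> gain i d' \<le> y"
    using best by (auto simp: best_old_def)
  show ?thesis
  proof (rule optimal_choiceI[OF assms(1)])
    show "cell_choice i k d y \<in> choices k"
      using d(1) by (auto simp: choices_eq[OF assms(2)] cell_choice_def)
  next
    fix d' assume "d' \<in> choices k"
    then consider "d' \<in> old_choices k" | "d' = k" "k < q" by (auto simp: choices_eq[OF assms(2)])
    then show "gain i d' + opt (p - Suc i) (next_used k d') \<le> gain i (cell_choice i k d y) +
      opt (p - Suc i) (next_used k (cell_choice i k d y))"
    proof cases
      case 1
      then show ?thesis
        using False d(1,2) next_used_old[OF assms(2)] d(3)[OF 1]
        by (auto simp: cell_choice_def gain_def[of i k] next_used_def[of k k])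
    next
      case 2
      then show ?thesis
        using False d(1,2) next_used_old[OF assms(2)]
        by (auto simp: cell_choice_def gain_def[of i k] next_used_def[of k k])
    qed
  qed
qed

text \<open>Exactly column \<open>k\<close> becomes old, so one comparison updates the maximum; this
  is what makes a cell cost constant time.\<close>

lemma best_old_Suc:
  assumes "i < p" "k < q" "best_old i k d y"
  shows "best_old i (Suc k) (if k < e \<or> y < c $$ (i, k) then k else d)
    (if k < e \<or> y < c $$ (i, k) then c $$ (i, k) else y)"
proof (cases "k < e")
  case True
  then have "k = 0" "e \<noteq> 0" using e_le by auto
  then show ?thesis using assms by (auto simp: best_old_def old_choices_def gain_def)
next
  case False
  have "old_choices (Suc k) = insert k (old_choices k)"
    by (auto simp: old_choices_def)
  then show ?thesis
    using False assms by (fastforce simp: best_old_def gain_def[of i k])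
qed

lemma best_old_0: "best_old i 0 (Suc q) 0"
  unfolding best_old_def old_choices_def by (simp add: gain_def)

lemma cell_step_effect:
  assumes inv: "row_inv i k s" and i: "i < p" and k: "k \<le> q"
  defines "d \<equiv> ivar s ''arg''" and "y \<equiv> rvar s ''best''"
  defines "s' \<equiv> effect cell_step s"
  shows "header s'" "ivar s' ''i'' = i" "ivar s' ''k'' = 0" "ivar s' ''m'' = Suc k"
    "imem s' = (imem s)(i * (q + 1) + k := cell_choice i k d y)"
    "rmem s' = (rmem s)(p * q + k := opt (p - i) k)"
    "k < q \<Longrightarrow> best_old i (Suc k) (ivar s' ''arg'') (rvar s' ''best'')"
proof -
  have regs: "ivar s ''p'' = p" "ivar s ''q'' = q" "ivar s ''e'' = e"
    "ivar s ''i'' = i" "ivar s ''k'' = 0" "ivar s ''m'' = k"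
    and best: "best_old i k d y"
    and opt1: "rmem s (p * q + k) = opt (p - Suc i) k"
    and opt2: "k < q \<Longrightarrow> rmem s (Suc (p * q + k)) = opt (p - Suc i) (Suc k)"
    and cost: "k < q \<Longrightarrow> rmem s (i * q + k) = c $$ (i, k)"
    using inv i k by (auto simp: row_inv_def header_def costs_stored_def d_def y_def
        simp flip: add_Suc_right)
  show "header s'" "ivar s' ''i'' = i" "ivar s' ''k'' = 0" "ivar s' ''m'' = Suc k"
    using regs by (simp_all add: s'_def cell_step_def header_def)
  show "imem s' = (imem s)(i * (q + 1) + k := cell_choice i k d y)"
    using regs opt1 opt2 cost by (simp add: s'_def cell_step_def cell_choice_def d_def y_def)
  \<comment> \<open>The optimal value is brought into the form of the expression that the program
    evaluates.\<close>
  have "opt (p - i) k = gain i (cell_choice i k d y) +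
      opt (p - Suc i) (next_used k (cell_choice i k d y))"
    using optimal_cell_choice[OF i k best] by (simp add: optimal_choice_def)
  also have "\<dots> = (if k < q \<and> (k < e \<or>
      y + opt (p - Suc i) k < c $$ (i, k) + opt (p - Suc i) (Suc k))
      then c $$ (i, k) + opt (p - Suc i) (Suc k) else y + opt (p - Suc i) k)"
  proof (cases "k < e")
    case True
    then have "k < q" using q_pos e_le by auto
    with True show ?thesis by (simp add: cell_choice_def gain_def next_used_def)
  next
    case False
    then have "gain i d = y" "next_used k d = k"
      using best next_used_old[OF k] by (auto simp: best_old_def)
    with False show ?thesis
      by (simp add: cell_choice_def gain_def[of i k] next_used_def[of k k])
  qed
  finally show "rmem s' = (rmem s)(p * q + k := opt (p - i) k)"
    using regs opt1 opt2 cost by (simp add: s'_def cell_step_def y_def)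
  assume "k < q"
  with best_old_Suc[OF i this best]
  show "best_old i (Suc k) (ivar s' ''arg'') (rvar s' ''best'')"
    using regs cost
    by (cases "k < e"; cases "y < c $$ (i, k)")
       (simp_all add: s'_def cell_step_def d_def y_def)
qed

text \<open>The stores hit one \<open>opt\<close> cell and one choice cell. Costs lie below
  \<open>p * q\<close> and choice addresses are injective, so all else survives.\<close>

lemma row_inv_step:
  assumes inv: "row_inv i k s" and i: "i < p" and k: "k \<le> q"
  shows "row_inv i (Suc k) (effect cell_step s)"
proof -
  note eff = cell_step_effect[OF inv i k]
  have best: "best_old i k (ivar s ''arg'') (rvar s ''best'')"
    using inv k by (simp add: row_inv_def)
  have "i * q + j \<noteq> p * q + k" if "j < q" for j
    using address_less[OF i that] by simp
  moreover have "i' * q + j \<noteq> p * q + k" if "i' < p" "j < q" for i' j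
    using address_less[OF that] by simp
  ultimately have "costs_stored (effect cell_step s)"
    using inv by (simp add: row_inv_def costs_stored_def eff(6))
  moreover have inj: "i' * (q + 1) + m = i * (q + 1) + k \<longleftrightarrow> i' = i \<and> m = k" if "m \<le> q" for i' m
    using address_inj[of m "q + 1" k i' i] that k by simp
  have "choices_stored (Suc i) (effect cell_step s)"
    using inv by (simp add: choices_stored_def eff(5) inj row_inv_def del: add_Suc_right One_nat_def)
  moreover have "\<forall>m<Suc k. optimal_choice i m (imem (effect cell_step s) (i * (q + 1) + m))"
    using inv optimal_cell_choice[OF i k best]
    by (simp add: eff(5) row_inv_def less_Suc_eq del: add_Suc_right)
  moreover have "Suc k \<le> q \<longrightarrow>
      best_old i (Suc k) (ivar (effect cell_step s) ''arg'') (rvar (effect cell_step s) ''best'')"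
    using eff(7) by simp
  ultimately show ?thesis
    using inv by (simp add: row_inv_def eff(1-4,6) less_Suc_eq)
qed

text \<open>A row has \<open>q + 1\<close> cells, and its loop test costs \<open>5\<close>.\<close>

lemma table_inv_step:
  assumes inv: "table_inv k s" and k: "k < p"
  shows "runs (Seq row_init row_loop) s
    (duration row_init + ((q + 1) * (5 + duration cell_step) + 5)) (table_inv (Suc k))"
proof (rule runs_Seq)
  define i where "i = p - Suc k"
  have i: "i < p" "p - k = Suc i" "p - i = Suc k" "p - Suc i = k" using k by (auto simp: i_def)
  show "runs row_init s (duration row_init) (row_inv i 0)"
  proof (rule runs_loop_free)
    show "row_inv i 0 (effect row_init s)"
      using inv i best_old_0[of i]
      by (simp add: row_init_def row_inv_def table_inv_def header_def costs_stored_def choices_stored_def)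
  qed simp_all
  fix s assume start: "row_inv i 0 s"
  have "runs row_loop s ((q + 1 - 0) * (5 + duration cell_step) + 5) (row_inv i (q + 1))"
    unfolding row_loop_def
  proof (rule runs_weaken[OF runs_While[where I = "row_inv i" and T = "duration cell_step", OF start]])
    fix k s assume "row_inv i k s" "k < q + 1"
    then show "bval (ILess (IVar ''m'') (IPlus (IVar ''q'') (IConst 1))) s \<and>
        runs cell_step s (duration cell_step) (row_inv i (Suc k))"
      using row_inv_step[of i k s] i(1)
      by (intro conjI runs_loop_free) (simp_all, simp add: row_inv_def header_def)
  qed (simp_all add: row_inv_def header_def algebra_simps)
  then show "runs row_loop s ((q + 1) * (5 + duration cell_step) + 5) (table_inv (Suc k))"
  proof (rule runs_weaken)
    fix s assume s: "row_inv i (q + 1) s"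
    have "choices_stored i s"
      using s by (auto simp: row_inv_def choices_stored_def less_Suc_eq_le le_eq_less_or_eq[of i])
    with s show "table_inv (Suc k) s"
      using i k by (auto simp: row_inv_def table_inv_def less_Suc_eq_le i_def)
  qed simp
qed

lemma table_loop_runs:
  assumes "table_inv 0 s"
  shows "runs table_loop s
    (p * (3 + (duration row_init + ((q + 1) * (5 + duration cell_step) + 5))) + 3) (table_inv p)"
  unfolding table_loop_def
proof (rule runs_weaken[OF runs_While[where I = table_inv, OF assms]])
  fix k s assume "table_inv k s" "k < p"
  then show "bval (ILess (IConst 0) (IVar ''i'')) s \<and> runs (Seq row_init row_loop) s
      (duration row_init + ((q + 1) * (5 + duration cell_step) + 5)) (table_inv (Suc k))"
    using table_inv_step by (simp add: table_inv_def)
qed (simp_all add: table_inv_def algebra_simps)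

section \<open>Writing the solution from the recorded choices\<close>

definition clear_inv :: "nat \<Rightarrow> state \<Rightarrow> bool" where
  "clear_inv k s \<longleftrightarrow> header s \<and> choices_stored 0 s \<and> ivar s ''i'' = 0 \<and> ivar s ''m'' = 0 \<and>
    ivar s ''k'' = k \<and> (\<forall>a<k. rmem s a = 0)"

lemma clear_loop_runs:
  assumes "clear_inv 0 s"
  shows "runs clear_loop s (p * q * (5 + duration clear_step) + 5) (clear_inv (p * q))"
proof -
  have "clear_inv (Suc k) (effect clear_step s)" if "clear_inv k s" for k s
    using that by (simp add: clear_inv_def clear_step_def header_def choices_stored_def less_Suc_eq)
  then have "runs clear_step s (duration clear_step) (clear_inv (Suc k))"
    if "clear_inv k s" for k s
    using that by (intro runs_loop_free) simp_all
  then show ?thesis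
    unfolding clear_loop_def
    by (intro runs_weaken[OF runs_While[where I = clear_inv, OF assms, where n = "p * q"
          and T = "duration clear_step"]])
       (simp_all add: clear_inv_def header_def algebra_simps)
qed

text \<open>The word has to satisfy \<open>w i = D i (used w i)\<close>, where \<open>used\<close>
  depends on \<open>w\<close> itself; recursion on the counter alone avoids the circularity.\<close>

primrec trace :: "(nat \<Rightarrow> nat \<Rightarrow> nat) \<Rightarrow> nat \<Rightarrow> nat" where
  "trace D 0 = 0"
| "trace D (Suc i) = next_used (trace D i) (D i (trace D i))"

definition trace_word :: "(nat \<Rightarrow> nat \<Rightarrow> nat) \<Rightarrow> nat \<Rightarrow> nat" where
  "trace_word D i = D i (trace D i)"

lemma used_trace_word: "used (trace_word D) i = trace D i"
  by (induction i) (auto simp: trace_word_def)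

definition write_inv :: "(nat \<Rightarrow> nat) \<Rightarrow> nat \<Rightarrow> state \<Rightarrow> bool" where
  "write_inv w k s \<longleftrightarrow> header s \<and> ivar s ''i'' = k \<and> ivar s ''m'' = used w k \<and>
    (\<forall>i<p. imem s (i * (q + 1) + used w i) = w i) \<and>
    (\<forall>i<p. \<forall>j<q. rmem s (i * q + j) = (if i < k \<and> w i = j then 1 else 0))"

lemma write_inv_step:
  assumes inv: "write_inv w k s" and k: "k < p"
  shows "write_inv w (Suc k) (effect write_step s)"
proof -
  define s' where "s' = effect write_step s"
  have regs: "ivar s ''p'' = p" "ivar s ''q'' = q" "ivar s ''e'' = e" "ivar s ''i'' = k"
    "ivar s ''m'' = used w k" "imem s (k * (q + 1) + used w k) = w k"
    using inv k by (auto simp: write_inv_def header_def)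
  have "header s'" "ivar s' ''i'' = Suc k" "ivar s' ''m'' = used w (Suc k)" "imem s' = imem s"
    "rmem s' = (if w k < q then (rmem s)(k * q + w k := 1) else rmem s)"
    using regs by (auto simp: s'_def write_step_def header_def next_used_def)
  moreover have "i * q + j = k * q + w k \<longleftrightarrow> i = k \<and> j = w k" if "j < q" "w k < q" for i j
    using address_inj[OF that] .
  ultimately show ?thesis
    using inv by (auto simp: write_inv_def less_Suc_eq simp flip: s'_def)
qed

lemma write_loop_runs:
  assumes "write_inv w 0 s"
  shows "runs write_loop s (p * (3 + duration write_step) + 3) (write_inv w p)"
proof -
  have "runs write_step s (duration write_step) (write_inv w (Suc k))"
    if "write_inv w k s" "k < p" for k s
    using write_inv_step[OF that] by (intro runs_loop_free) simp_all
  then show ?thesis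
    unfolding write_loop_def
    by (intro runs_weaken[OF runs_While[where I = "write_inv w", OF assms, where n = p
          and T = "duration write_step"]])
       (simp_all add: write_inv_def header_def algebra_simps)
qed

lemma clear_write_runs:
  assumes "clear_inv 0 s"
  shows "runs (Seq clear_loop write_loop) s
    ((p * q * (5 + duration clear_step) + 5) + (p * (3 + duration write_step) + 3))
    (\<lambda>s. is_arg_max (mat_inner c) (\<lambda>A. A \<in> maximal_mats) (output_mat p q s))"
proof (rule runs_Seq[OF clear_loop_runs[OF assms]])
  fix s assume s: "clear_inv (p * q) s"
  define w where "w = trace_word (\<lambda>i m. imem s (i * (q + 1) + m))"
  have w_eq: "w i = imem s (i * (q + 1) + used w i)" for i
    by (simp add: w_def used_trace_word) (simp add: trace_word_def)
  \<comment> \<open>The bound by \<open>q\<close> is carried along because the table covers only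
    \<open>m \<le> q\<close>.\<close>
  have opt_le: "optimal_choice i (used w i) (w i) \<and> used w i \<le> q" if "i < p" for i
    using that
  proof (induction i)
    case 0
    have "optimal_choice 0 0 (w 0)"
      using s 0 w_eq[of 0] by (auto simp: clear_inv_def choices_stored_def)
    then show ?case by simp
  next
    case (Suc i)
    then have "used w (Suc i) \<le> q" by (auto simp: optimal_choice_def intro: next_used_le)
    moreover have "choices_stored 0 s" using s by (simp add: clear_inv_def)
    then have "\<forall>m\<le>q. optimal_choice (Suc i) m (imem s (Suc i * (q + 1) + m))"
      using Suc.prems le0 unfolding choices_stored_def by blast
    ultimately show ?case using w_eq[of "Suc i"] by metis
  qed
  have "rmem s (i * q + j) = 0" if "i < p" "j < q" for i j
    using s address_less[OF that] by (simp add: clear_inv_def)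
  then have "write_inv w 0 s"
    using s w_eq by (simp add: write_inv_def clear_inv_def)
  from write_loop_runs[OF this]
  show "runs write_loop s (p * (3 + duration write_step) + 3)
    (\<lambda>s. is_arg_max (mat_inner c) (\<lambda>A. A \<in> maximal_mats) (output_mat p q s))"
  proof (rule runs_weaken)
    fix s assume "write_inv w p s"
    then have "output_mat p q s = word_mat w"
      by (auto simp: output_mat_def word_mat_def write_inv_def intro!: cong_mat)
    then show "is_arg_max (mat_inner c) (\<lambda>A. A \<in> maximal_mats) (output_mat p q s)"
      using optimal_word[of w] opt_le by simp
  qed simp
qed

text \<open>The summands are the phases of the program; each \<open>4\<close> pays for two register
  assignments.\<close>

lemma dp_program_runs:
  "runs (dp_program e) (input_state p q c)
    (4 + ((p * (3 + (duration row_init + ((q + 1) * (5 + duration cell_step) + 5))) + 3) +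
    (4 + ((p * q * (5 + duration clear_step) + 5) + (p * (3 + duration write_step) + 3)))))
    (\<lambda>s. is_arg_max (mat_inner c) (\<lambda>A. A \<in> maximal_mats) (output_mat p q s))"
  unfolding dp_program_def
proof (rule runs_Seq[OF runs_loop_free runs_Seq[OF table_loop_runs
      runs_Seq[OF runs_loop_free clear_write_runs]]])
  have "rmem (input_state p q c) (i * q + j) = c $$ (i, j)" if "i < p" "j < q" for i j
    using address_less[OF that] that by (simp add: input_state_def)
  then show "table_inv 0 (effect (Seq (IAssign ''e'' (IConst e)) (IAssign ''i'' (IVar ''p''))) (input_state p q c))"
    by (simp add: table_inv_def header_def costs_stored_def choices_stored_def)
       (simp add: input_state_def)
next
  fix s assume "table_inv p s"
  then show "clear_inv 0 (effect (Seq (IAssign ''k'' (IConst 0)) (IAssign ''m'' (IConst 0))) s)"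
    by (simp add: table_inv_def clear_inv_def header_def choices_stored_def)
qed auto

end

text \<open>The program depends only on \<open>e\<close>, so it serves all dimensions and objectives
  at once.\<close>

lemma linear_optimization_growth:
  assumes e: "e \<le> 1"
    and X: "\<And>p q. 0 < q \<Longrightarrow> X p q = growth_words.maximal_mats p q e"
  shows "linear_optimization_in_time X (\<lambda>p q. p\<^sup>2 * q)"
proof -
  \<comment> \<open>Bounding \<open>1\<close> and \<open>p\<close> by \<open>p * q\<close> adds up
    the coefficients, with \<open>45 = 19 + 16 + 10\<close>; finally \<open>p * q\<close> is at most
    \<open>p\<^sup>2 * q\<close>.\<close>
  let ?K = "45 + duration row_init + 2 * duration cell_step + duration clear_step + duration write_step"
  have "\<exists>t s. exec (dp_program e) (input_state p q c) t s \<and> t \<le> ?K * (p\<^sup>2 * q) \<and>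
      is_arg_max (mat_inner c) (\<lambda>A. A \<in> X p q) (output_mat p q s)"
    if pq: "0 < p" "0 < q" and c: "c \<in> carrier_mat p q" for p q c
  proof -
    interpret growth_dp p q e c
      using e pq c by unfold_locales
    have time: "4 + ((p * (3 + (a + ((q + 1) * (5 + b) + 5))) + 3) +
        (4 + ((p * q * (5 + d) + 5) + (p * (3 + f) + 3))))
      \<le> (45 + a + 2 * b + d + f) * (p\<^sup>2 * q)" for a b d f
    proof -
      have "4 + ((p * (3 + (a + ((q + 1) * (5 + b) + 5))) + 3) +
          (4 + ((p * q * (5 + d) + 5) + (p * (3 + f) + 3)))) =
        19 * 1 + p * (16 + a + b + f) + p * q * (10 + b + d)"
        by (simp add: algebra_simps)
      also have "\<dots> \<le> 19 * (p * q) + p * q * (16 + a + b + f) + p * q * (10 + b + d)"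
        using pq by (intro add_mono mult_le_mono mult_le_mono1) (simp_all add: Suc_leI)
      also have "\<dots> = (45 + a + 2 * b + d + f) * (p * q)"
        by (simp add: algebra_simps)
      also have "\<dots> \<le> (45 + a + 2 * b + d + f) * (p\<^sup>2 * q)"
        using pq by (intro mult_le_mono2) (simp add: power2_eq_square)
      finally show ?thesis .
    qed
    show ?thesis
      using dp_program_runs le_trans[OF _ time] unfolding runs_def X[OF pq(2)] by blast
  qed
  then show ?thesis unfolding linear_optimization_in_time_def by blast
qed

lemma max_packing_mats_eq: "0 < q \<Longrightarrow> max_packing_mats p q = growth_words.maximal_mats p q 0"
  using growth_words.maximal_mats_def[of q 0 p]
  by (simp add: max_packing_mats_def growth_words_def)

lemma max_partitioning_mats_eq:
  "0 < q \<Longrightarrow> max_partitioning_mats p q = growth_words.maximal_mats p q 1"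
  using growth_words.maximal_mats_def[of q 1 p]
  by (auto simp: max_partitioning_mats_def growth_words_def)

theorem theorem2:
  shows "linear_optimization_in_time max_packing_mats (\<lambda>p q. p\<^sup>2 * q) \<and>
    linear_optimization_in_time max_partitioning_mats (\<lambda>p q. p\<^sup>2 * q)"
  using linear_optimization_growth[OF _ max_packing_mats_eq]
    linear_optimization_growth[OF _ max_partitioning_mats_eq] by simp

end
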